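(* Let $a,b,t$ be indeterminates, and let $n,k,r$ be integers with $0\le k\le n$ and $r\ge 0$. Then $$\delta_{n,k}=\sum_{j=k}^n (-1)^{j-k}\,\mathcal{G}_{a,b}(n,j;r)\,\mathcal{G}_{b,a}(j,k;r)$$ and $$\mathcal{G}_{a,b}(n,k;r)=\sum_{j=k}^n \mathcal{G}_{a,t}(n,j;r)\,\mathcal{G}_{-t,b}(j,k;r),$$ where $\delta_{n,k}$ is the Kronecker delta.
   Context: Write $[m]=\{1,\ldots,m\}$, $[0]=\varnothing$. A Lah distribution of $[m]$ into $\ell$ blocks is a partition of $[m]$ into $\ell$ non-empty, pairwise disjoint blocks in which the elements within each block are linearly ordered (the blocks themselves are not ordered). For integers $n,k,r$ with $0\le k\le n$ and $r\ge 0$, let $\mathcal{L}_r(n,k)$ be the set of Lah distributions of $[n+r]$ into $k+r$ blocks in which the elements of $[r]$ belong to distinct blocks. An element $i$ of a Lah distribution $\lambda$ is a record low if there is no element $j<i$ to the left of $i$ within its block. Let $rec^*(\lambda)$ be the number of record lows of $\lambda$ that are not the smallest element of their block, and let $nrec(\lambda)$ be the number of elements of the underlying set that are not record lows of $\lambda$. The generalized $r$-Lah number is the polynomial in indeterminates $a,b$ $$\mathcal{G}_{a,b}(n,k;r)=\sum_{\lambda\in\mathcal{L}_r(n,k)}a^{nrec(\lambda)}b^{rec^*(\lambda)},$$ with $\mathcal{G}_{a,b}(n,k;r)=0$ unless $0\le k\le n$ and $r\ge 0$. For other subscripts, $\mathcal{G}_{u,v}(n,k;r)$ denotes the result of substituting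 $a=u$, $b=v$ in this polynomial. *)

theory Defs
  imports "HOL-Library.Disjoint_Sets" "HOL-Computational_Algebra.Polynomial"
begin

text \<open>A block is the list of its elements in their linear order, and a Lah distribution is the
  (unordered) set of its blocks.\<close>

definition lah_distributions :: "nat \<Rightarrow> nat \<Rightarrow> nat list set set" where
  "lah_distributions m l =
     {D. partition_on {1..m} (set ` D) \<and> inj_on set D \<and> (\<forall>xs\<in>D. distinct xs) \<and> card D = l}"

definition r_lah_distributions :: "nat \<Rightarrow> nat \<Rightarrow> nat \<Rightarrow> nat list set set" where
  "r_lah_distributions r n k =
     {D \<in> lah_distributions (n + r) (k + r).
        \<forall>xs\<in>D. \<forall>i\<in>{1..r}. \<forall>j\<in>{1..r}. i \<in> set xs \<and> j \<in> set xs \<longrightarrow> i = j}"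

definition record_low :: "nat list \<Rightarrow> nat \<Rightarrow> bool" where
  "record_low xs i \<longleftrightarrow> (\<exists>ys zs. xs = ys @ i # zs \<and> \<not> (\<exists>j\<in>set ys. j < i))"

definition rec_star :: "nat list set \<Rightarrow> nat" where
  "rec_star D = card {i. \<exists>xs\<in>D. record_low xs i \<and> i \<noteq> Min (set xs)}"

definition nrec :: "nat list set \<Rightarrow> nat" where
  "nrec D = card {i \<in> \<Union> (set ` D). \<not> (\<exists>xs\<in>D. record_low xs i)}"

text \<open>The generalized \<open>r\<close>-Lah number, as an element of \<open>\<int>[a][b]\<close>: the inner indeterminate
  is \<open>a\<close>, the outer one is \<open>b\<close>. For \<open>k > n\<close> the index set is empty, so the value is \<open>0\<close>.\<close>

definition glah_poly :: "nat \<Rightarrow> nat \<Rightarrow> nat \<Rightarrow> int poly poly" where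
  "glah_poly n k r =
     (\<Sum>D\<in>r_lah_distributions r n k. monom (monom 1 (nrec D)) (rec_star D))"

text \<open>The result of substituting \<open>a = u\<close> and \<open>b = v\<close>.\<close>

definition glah :: "'a::comm_ring_1 \<Rightarrow> 'a \<Rightarrow> nat \<Rightarrow> nat \<Rightarrow> nat \<Rightarrow> 'a" where
  "glah u v n k r =
     poly (map_poly (\<lambda>p. poly (map_poly of_int p) u) (glah_poly n k r)) v"

end

theory Submission
  imports Defs
begin

text \<open>Consider inserting the largest element \<open>m = n + r + 1\<close> into a Lah distribution of \<open>[n + r]\<close> into
  \<open>k + r\<close> blocks. As a new block it contributes the factor \<open>1\<close>; in front of an existing block it is
  a record low but not the minimum, factor \<open>b\<close>; directly after one of the \<open>n + r\<close> elements it is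
  not a record low, factor \<open>a\<close>; and no other statistic changes. Hence
  \<open>G(n + 1, k) = G(n, k - 1) + (a (n + r) + b (k + r)) G(n, k)\<close>. In the convolution of \<open>G\<^bsub>a,t\<^esub>\<close> and
  \<open>G\<^bsub>-t,b\<^esub>\<close> the terms \<open>\<plusminus>t (j + r)\<close> cancel, so the convolution satisfies the recurrence of
  \<open>G\<^bsub>a,b\<^esub>\<close>. Orthogonality is the case \<open>b = -a\<close>, because \<open>(-1)\<^sup>j\<^sup>-\<^sup>k G\<^bsub>b,a\<^esub>(j, k) = G\<^bsub>-b,-a\<^esub>(j, k)\<close> and
  \<open>G\<^bsub>a,-a\<^esub>(n, k) = \<delta>\<^bsub>n,k\<^esub>\<close>.\<close>

section \<open>Substitution into the polynomial as a weighted count\<close>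

lemma poly_map_poly_of_int_add:
  "poly (map_poly of_int (p + q)) (u::'a::comm_ring_1) =
     poly (map_poly of_int p) u + poly (map_poly of_int q) u"
proof -
  have "map_poly (of_int :: int \<Rightarrow> 'a) (p + q) = map_poly of_int p + map_poly of_int q"
    by (intro poly_eqI) (simp add: coeff_map_poly)
  then show ?thesis by simp
qed

text \<open>Evaluation is additive, so the sum defining \<open>glah_poly\<close> may be evaluated
  term by term; each term is a single monomial.\<close>

lemma glah_eq_sum:
  "glah u v n k r = (\<Sum>D\<in>r_lah_distributions r n k. u ^ nrec D * v ^ rec_star D)"
proof -
  \<comment> \<open>\<open>f\<close> substitutes \<open>u\<close> for the inner indeterminate; the
    outer one is evaluated at \<open>v\<close> afterwards.\<close>
  define f where "f = (\<lambda>p. poly (map_poly of_int p) u)"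
  have f0: "f 0 = 0" by (simp add: f_def)
  have f_add: "f (p + q) = f p + f q" for p q
    by (simp add: f_def poly_map_poly_of_int_add)
  have "poly (map_poly f (\<Sum>D\<in>A. monom (monom 1 (nrec D)) (rec_star D))) v =
        (\<Sum>D\<in>A. u ^ nrec D * v ^ rec_star D)" for A
  proof (induction A rule: infinite_finite_induct)
    case (insert D A)
    have "map_poly f (p + q) = map_poly f p + map_poly f q" for p q
      by (intro poly_eqI) (simp add: coeff_map_poly f0 f_add)
    moreover have "map_poly f (monom c i) = monom (f c) i" for c i
      by (rule map_poly_monom) (rule f0)
    moreover have "f (monom 1 i) = u ^ i" for i
      by (simp add: f_def map_poly_monom poly_monom)
    ultimately show ?case using insert by (simp add: poly_monom)
  qed simp_all
  then show ?thesis by (simp add: glah_def glah_poly_def f_def)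
qed

section \<open>Record lows and weights within a single block\<close>

lemma record_low_in_set: "record_low xs i \<Longrightarrow> i \<in> set xs"
  by (auto simp: record_low_def)

lemma record_low_Nil [simp]: "\<not> record_low [] i"
  by (simp add: record_low_def)

lemma record_low_Cons:
  "record_low (x # xs) i \<longleftrightarrow> i = x \<or> \<not> x < i \<and> record_low xs i"
  unfolding record_low_def by (auto simp: Cons_eq_append_conv) (metis set_ConsD)+

lemma record_low_append:
  "record_low (xs @ ys) i \<longleftrightarrow> record_low xs i \<or> (\<forall>x\<in>set xs. \<not> x < i) \<and> record_low ys i"
  by (induction xs) (auto simp: record_low_Cons)

definition block_nrec :: "nat list \<Rightarrow> nat" where
  "block_nrec xs = card {i \<in> set xs. \<not> record_low xs i}"

definition block_rec_star :: "nat list \<Rightarrow> nat" where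
  "block_rec_star xs = card {i. record_low xs i \<and> i \<noteq> Min (set xs)}"

text \<open>Both statistics turn out to be additive over the blocks, so the product of these weights
  over a distribution is its monomial.\<close>

definition block_weight :: "'a::comm_ring_1 \<Rightarrow> 'a \<Rightarrow> nat list \<Rightarrow> 'a" where
  "block_weight u v xs = u ^ block_nrec xs * v ^ block_rec_star xs"

text \<open>A larger element to the left never spoils a record low, and the maximum itself is one
  only when nothing precedes it.\<close>

lemma record_low_insert_max:
  assumes "\<forall>x\<in>set (p @ q). x < m"
  shows "record_low (p @ m # q) i \<longleftrightarrow> (if i = m then p = [] else record_low (p @ q) i)"
proof (cases "i = m")
  case True
  then show ?thesis using assms record_low_in_set[of p m] record_low_in_set[of q m]
    by (cases p) (auto simp: record_low_append record_low_Cons)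
next
  case False
  then show ?thesis using assms record_low_in_set[of q i]
    by (auto simp: record_low_append record_low_Cons dest: bspec[of _ _ i])
qed

lemma block_weight_singleton: "block_weight u v [m] = 1"
proof -
  have "block_nrec [m] = 0" "block_rec_star [m] = 0"
    by (auto simp: block_nrec_def block_rec_star_def record_low_Cons)
  then show ?thesis by (simp add: block_weight_def)
qed

text \<open>The old block is non-empty and lies below \<open>m\<close>, so its minimum stays the
  minimum. Hence \<open>m\<close> raises \<open>block_rec_star\<close> by one when it comes first
  and \<open>block_nrec\<close> by one otherwise.\<close>

lemma block_weight_insert_max:
  assumes less: "\<forall>x\<in>set (p @ q). x < m" and ne: "p @ q \<noteq> []"
  shows "block_weight u v (p @ m # q) = (if p = [] then v else u) * block_weight u v (p @ q)"
proof -
  let ?xs = "p @ q" and ?ys = "p @ m # q"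
  have m: "m \<notin> set ?xs" using less by blast
  have "Min (set ?ys) = Min (insert m (set ?xs))" by simp
  also have "\<dots> = min m (Min (set ?xs))" using ne by (intro Min_insert) auto
  also have "Min (set ?xs) < m" using less ne Min_in[of "set ?xs"] by auto
  then have "min m (Min (set ?xs)) = Min (set ?xs)" by simp
  finally have Min: "Min (set ?ys) = Min (set ?xs)" .
  have Min_ne: "Min (set ?xs) \<noteq> m" using \<open>Min (set ?xs) < m\<close> by simp
  have nr: "{i \<in> set ?ys. \<not> record_low ?ys i} =
        (if p = [] then {} else {m}) \<union> {i \<in> set ?xs. \<not> record_low ?xs i}"
    using m by (auto simp: record_low_insert_max[OF less])
  have rs: "{i. record_low ?ys i \<and> i \<noteq> Min (set ?ys)} =
        (if p = [] then {m} else {}) \<union> {i. record_low ?xs i \<and> i \<noteq> Min (set ?xs)}"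
    unfolding Min using m Min_ne record_low_in_set[of ?xs]
    by (auto simp: record_low_insert_max[OF less])
  have fin: "finite {i. record_low ?xs i \<and> i \<noteq> Min (set ?xs)}"
    by (rule finite_subset[of _ "set ?xs"]) (auto dest: record_low_in_set)
  have notin: "m \<notin> {i. record_low ?xs i \<and> i \<noteq> Min (set ?xs)}"
    "m \<notin> {i \<in> set ?xs. \<not> record_low ?xs i}"
    using m record_low_in_set[of ?xs m] by auto
  have "block_nrec ?ys = (if p = [] then 0 else 1) + block_nrec ?xs"
    unfolding block_nrec_def nr using notin(2) by simp
  moreover have "block_rec_star ?ys = (if p = [] then 1 else 0) + block_rec_star ?xs"
    unfolding block_rec_star_def rs using card_insert_disjoint[OF fin notin(1)]
    by (cases "p = []") (simp_all del: card_insert_disjoint)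
  ultimately show ?thesis by (simp add: block_weight_def)
qed

section \<open>Lah distributions as sets of lists, and additivity of the statistics\<close>

definition list_partition :: "nat set \<Rightarrow> nat list set \<Rightarrow> bool" where
  "list_partition A D \<longleftrightarrow> (\<forall>xs\<in>D. xs \<noteq> [] \<and> distinct xs) \<and>
     (\<forall>xs\<in>D. \<forall>ys\<in>D. xs \<noteq> ys \<longrightarrow> set xs \<inter> set ys = {}) \<and> \<Union> (set ` D) = A"

text \<open>Stating disjointness for the lists rather than for their underlying sets absorbs the
  injectivity of \<open>set\<close>: two distinct lists on the same non-empty set would not be
  disjoint.\<close>

lemma list_partition_iff:
  "list_partition A D \<longleftrightarrow>
     partition_on A (set ` D) \<and> inj_on set D \<and> (\<forall>xs\<in>D. distinct xs)"
proof
  assume D: "list_partition A D"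
  have "inj_on set D"
    using D unfolding list_partition_def inj_on_def by (metis inf.idem set_empty)
  then show "partition_on A (set ` D) \<and> inj_on set D \<and> (\<forall>xs\<in>D. distinct xs)"
    using D unfolding list_partition_def partition_on_def disjoint_def by fastforce
next
  assume D: "partition_on A (set ` D) \<and> inj_on set D \<and> (\<forall>xs\<in>D. distinct xs)"
  then have "set xs \<inter> set ys = {}" if "xs \<in> D" "ys \<in> D" "xs \<noteq> ys" for xs ys
    using that unfolding partition_on_def disjoint_def inj_on_def by blast
  then show "list_partition A D"
    using D unfolding list_partition_def partition_on_def by auto
qed

lemma list_partition_finite:
  assumes "list_partition A D" "finite A"
  shows "finite D"
proof -
  have "set ` D \<subseteq> Pow A" using assms(1) by (auto simp: list_partition_def)
  then have "finite (set ` D)" using assms(2) by (meson finite_Pow_iff finite_subset)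
  then show ?thesis using assms(1) finite_imageD by (auto simp: list_partition_iff)
qed

text \<open>A record low of a block lies in that block, and every element lies in just one block. So
  being no record low anywhere is a condition on the element's own block, and the set counted splits
  disjointly.\<close>

lemma nrec_eq_sum:
  assumes "list_partition A D" "finite A"
  shows "nrec D = (\<Sum>xs\<in>D. block_nrec xs)"
proof -
  have dis: "xs = ys" if "xs \<in> D" "ys \<in> D" "i \<in> set xs" "i \<in> set ys" for xs ys i
    using assms(1) that unfolding list_partition_def by blast
  have "{i \<in> \<Union> (set ` D). \<not> (\<exists>xs\<in>D. record_low xs i)} =
      (\<Union>xs\<in>D. {i \<in> set xs. \<not> record_low xs i})"
    by (auto dest: dis record_low_in_set)
  moreover have "card \<dots> = (\<Sum>xs\<in>D. block_nrec xs)" unfolding block_nrec_def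
    by (rule card_UN_disjoint) (auto simp: list_partition_finite[OF assms] dest: dis)
  ultimately show ?thesis by (simp add: nrec_def)
qed

lemma rec_star_eq_sum:
  assumes "list_partition A D" "finite A"
  shows "rec_star D = (\<Sum>xs\<in>D. block_rec_star xs)"
proof -
  have dis: "xs = ys" if "xs \<in> D" "ys \<in> D" "i \<in> set xs" "i \<in> set ys" for xs ys i
    using assms(1) that unfolding list_partition_def by blast
  have fin: "finite {i. record_low xs i \<and> i \<noteq> Min (set xs)}" for xs
    by (rule finite_subset[of _ "set xs"]) (auto dest: record_low_in_set)
  have "{i. \<exists>xs\<in>D. record_low xs i \<and> i \<noteq> Min (set xs)} =
      (\<Union>xs\<in>D. {i. record_low xs i \<and> i \<noteq> Min (set xs)})"
    by auto
  moreover have "card \<dots> = (\<Sum>xs\<in>D. block_rec_star xs)" unfolding block_rec_star_def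
    by (rule card_UN_disjoint)
      (auto simp: list_partition_finite[OF assms] fin dest: dis record_low_in_set)
  ultimately show ?thesis by (simp add: rec_star_def)
qed

section \<open>Separated partitions, their total weight, and the base case\<close>

definition separated :: "nat \<Rightarrow> nat list \<Rightarrow> bool" where
  "separated r xs \<longleftrightarrow> (\<forall>i\<in>{1..r}. \<forall>j\<in>{1..r}. i \<in> set xs \<and> j \<in> set xs \<longrightarrow> i = j)"

text \<open>Here \<open>l\<close> is the total number of blocks, written \<open>k + r\<close> in the paper. Leaving \<open>l\<close> free admits
  \<open>l < r\<close>, so that the vanishing there (a pigeonhole fact) comes out of the recurrence.\<close>

definition separated_partitions :: "nat \<Rightarrow> nat \<Rightarrow> nat \<Rightarrow> nat list set set" where
  "separated_partitions r N l =
     {D. list_partition {1..N} D \<and> card D = l \<and> (\<forall>xs\<in>D. separated r xs)}"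

definition weight_sum :: "'a::comm_ring_1 \<Rightarrow> 'a \<Rightarrow> nat \<Rightarrow> nat \<Rightarrow> nat \<Rightarrow> 'a" where
  "weight_sum u v r N l =
     (\<Sum>D\<in>separated_partitions r N l. \<Prod>xs\<in>D. block_weight u v xs)"

lemma glah_eq_weight_sum: "glah u v n k r = weight_sum u v r (n + r) (k + r)"
proof -
  have "r_lah_distributions r n k = separated_partitions r (n + r) (k + r)"
    unfolding r_lah_distributions_def lah_distributions_def separated_partitions_def
      separated_def list_partition_iff by blast
  moreover have "u ^ nrec D * v ^ rec_star D = (\<Prod>xs\<in>D. block_weight u v xs)"
    if "D \<in> separated_partitions r (n + r) (k + r)" for D
  proof -
    have "list_partition {1..n + r} D" using that by (simp add: separated_partitions_def)
    from nrec_eq_sum[OF this] rec_star_eq_sum[OF this] show ?thesis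
      by (simp add: block_weight_def prod.distrib power_sum)
  qed
  ultimately show ?thesis by (simp add: glah_eq_sum weight_sum_def)
qed

text \<open>When the ground set is \<open>{1..r}\<close>, separation forces every block to be a
  singleton. One distribution remains, with \<open>r\<close> blocks and weight 1.\<close>

lemma weight_sum_diagonal: "weight_sum u v r r l = (if l = r then 1 else 0)"
proof -
  define E where "E = (\<lambda>i::nat. [i]) ` {1..r}"
  have uniq: "D = E" if D: "list_partition {1..r} D"
    and sep: "\<forall>xs\<in>D. separated r xs" for D
  proof -
    have single: "xs = [i]" if "xs \<in> D" "i \<in> set xs" for xs i
    proof -
      have "set xs \<subseteq> {1..r}" using D that by (auto simp: list_partition_def)
      then have "set xs = {i}" using sep that unfolding separated_def by blast
      moreover have "distinct xs" using D that by (auto simp: list_partition_def)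
      ultimately have "length xs = 1" using distinct_card[of xs] by simp
      then obtain j where "xs = [j]" by (auto simp: length_Suc_conv)
      with that(2) show ?thesis by simp
    qed
    show ?thesis
    proof
      show "D \<subseteq> E"
      proof
        fix xs assume xs: "xs \<in> D"
        then obtain i where i: "i \<in> set xs"
          using D by (metis list_partition_def ex_in_conv set_empty)
        then have "i \<in> {1..r}" using D xs by (auto simp: list_partition_def)
        then show "xs \<in> E" using single[OF xs i] by (simp add: E_def)
      qed
      show "E \<subseteq> D"
      proof
        fix xs assume "xs \<in> E"
        then obtain i where i: "i \<in> {1..r}" "xs = [i]" by (auto simp: E_def)
        then have "i \<in> \<Union> (set ` D)" using D by (simp add: list_partition_def)
        then obtain ys where "ys \<in> D" "i \<in> set ys" by blast
        with single i show "xs \<in> D" by metis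
      qed
    qed
  qed
  have "list_partition {1..r} E" by (auto simp: list_partition_def E_def)
  moreover have "\<forall>xs\<in>E. separated r xs"
    by (auto simp: E_def separated_def)
  moreover have card: "card E = r" by (simp add: E_def card_image inj_on_def)
  ultimately have "separated_partitions r r l = (if l = r then {E} else {})"
  proof -
    have "D \<in> separated_partitions r r l \<longleftrightarrow> D = E \<and> l = r" for D
      unfolding separated_partitions_def mem_Collect_eq using uniq[of D] \<open>list_partition {1..r} E\<close>
        \<open>\<forall>xs\<in>E. separated r xs\<close> card by metis
    then show ?thesis by (cases "l = r") (simp_all add: set_eq_iff)
  qed
  moreover have "(\<Prod>xs\<in>E. block_weight u v xs) = 1"
    by (rule prod.neutral) (auto simp: E_def block_weight_singleton)
  ultimately show ?thesis by (simp add: weight_sum_def)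
qed

section \<open>Adding, removing and replacing blocks\<close>

lemma list_partition_insert:
  assumes "list_partition A D" "set xs \<inter> A = {}" "xs \<noteq> []" "distinct xs"
  shows "list_partition (A \<union> set xs) (insert xs D)" "xs \<notin> D"
proof -
  have "set xs \<inter> set ys = {}" if "ys \<in> D" for ys
    using assms(1,2) that by (auto simp: list_partition_def)
  then show "list_partition (A \<union> set xs) (insert xs D)"
    using assms by (auto simp: list_partition_def)
  show "xs \<notin> D"
  proof
    assume "xs \<in> D"
    then have "set xs \<subseteq> A" using assms(1) by (auto simp: list_partition_def)
    with assms(2,3) show False by (simp add: inf.absorb1)
  qed
qed

lemma list_partition_remove:
  assumes "list_partition A D" "xs \<in> D"
  shows "list_partition (A - set xs) (D - {xs})"
  using assms unfolding list_partition_def by blast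

text \<open>This serves both directions of the insertion bijection: \<open>ys\<close> is
  \<open>xs\<close> with the maximum put in, or with the maximum taken out.\<close>

lemma list_partition_replace:
  assumes "list_partition A D" "finite A" "xs \<in> D"
    and "set ys \<inter> (A - set xs) = {}" "ys \<noteq> []" "distinct ys"
  shows "list_partition (A - set xs \<union> set ys) (insert ys (D - {xs}))"
    and "ys \<notin> D - {xs}" "card (insert ys (D - {xs})) = card D"
proof -
  have D': "list_partition (A - set xs) (D - {xs})"
    by (rule list_partition_remove) (use assms in auto)
  show "list_partition (A - set xs \<union> set ys) (insert ys (D - {xs}))"
    by (rule list_partition_insert(1)[OF D']) (use assms in auto)
  show notin: "ys \<notin> D - {xs}"
    by (rule list_partition_insert(2)[OF D']) (use assms in auto)
  have "finite D" by (rule list_partition_finite) (use assms in auto)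
  with notin show "card (insert ys (D - {xs})) = card D"
    by (metis assms(3) card.remove card_insert_disjoint finite_Diff)
qed

text \<open>Each element offers one place directly after it; this count supplies the term
  \<open>u * of_nat N\<close> of the recurrence.\<close>

lemma list_partition_sum_length:
  assumes "list_partition A D" "finite A"
  shows "(\<Sum>xs\<in>D. length xs) = card A"
proof -
  have "card A = card (\<Union>xs\<in>D. set xs)" using assms(1) by (simp add: list_partition_def)
  also have "\<dots> = (\<Sum>xs\<in>D. card (set xs))"
    by (rule card_UN_disjoint) (use assms list_partition_finite in \<open>auto simp: list_partition_def\<close>)
  also have "\<dots> = (\<Sum>xs\<in>D. length xs)"
    by (rule sum.cong) (use assms(1) in \<open>auto simp: list_partition_def distinct_card\<close>)
  finally show ?thesis by simp
qed

lemma separated_insert_max: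
  "r < m \<Longrightarrow> separated r (p @ m # q) \<longleftrightarrow> separated r (p @ q)"
  by (auto simp: separated_def)

lemma finite_separated_partitions: "finite (separated_partitions r N l)"
proof -
  have "separated_partitions r N l \<subseteq> Pow {xs. set xs \<subseteq> {1..N} \<and> distinct xs}"
    by (auto simp: separated_partitions_def list_partition_def)
  moreover have "finite {xs. set xs \<subseteq> {1..N} \<and> distinct xs}"
    by (rule finite_subset_distinct) simp
  ultimately show ?thesis by (meson finite_Pow_iff finite_subset)
qed

section \<open>Insertion of the largest element and the recurrence for the total weight\<close>

definition insert_at :: "'b \<Rightarrow> nat \<Rightarrow> 'b list \<Rightarrow> 'b list" where
  "insert_at m i xs = take i xs @ m # drop i xs"

lemma set_insert_at [simp]: "set (insert_at m i xs) = insert m (set xs)"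
proof -
  have "set (insert_at m i xs) = insert m (set (take i xs @ drop i xs))"
    unfolding insert_at_def set_append by simp
  then show ?thesis by simp
qed

lemma distinct_insert_at:
  assumes "distinct xs" "m \<notin> set xs"
  shows "distinct (insert_at m i xs)"
proof -
  have "m \<notin> set (take i xs)" "m \<notin> set (drop i xs)"
    using assms(2) in_set_takeD in_set_dropD by fast+
  then show ?thesis using assms set_take_disj_set_drop_if_distinct[OF assms(1), of i i]
    by (auto simp: insert_at_def)
qed

text \<open>The only occurrence of \<open>m\<close> marks the cut. The bounds on \<open>i\<close>
  and \<open>j\<close> matter because all positions beyond the end give the same list.\<close>

lemma insert_at_inject:
  assumes "insert_at m i xs = insert_at m j ys" "m \<notin> set xs" "m \<notin> set ys"
    "i \<le> length xs" "j \<le> length ys"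
  shows "xs = ys" "i = j"
proof -
  have "m \<notin> set (take i xs)" "m \<notin> set (take j ys)" "m \<notin> set (drop i xs)" "m \<notin> set (drop j ys)"
    using assms(2,3) in_set_takeD in_set_dropD by fast+
  then have eq: "take i xs = take j ys \<and> drop i xs = drop j ys"
    using assms(1) unfolding insert_at_def by (simp add: append_Cons_eq_iff)
  then show "xs = ys" by (metis append_take_drop_id)
  show "i = j" using eq assms(4,5) by (metis length_take min.absorb2)
qed

lemma list_partition_unique_block:
  "list_partition A D \<Longrightarrow> xs \<in> D \<Longrightarrow> ys \<in> D \<Longrightarrow> i \<in> set xs \<Longrightarrow> i \<in> set ys \<Longrightarrow> xs = ys"
  unfolding list_partition_def by blast

text \<open>Adding and removing the block \<open>[Suc N]\<close> are mutually inverse, and this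
  block has weight 1.\<close>

lemma weight_sum_new_block:
  assumes "r \<le> N"
  shows "(\<Sum>D\<in>{D \<in> separated_partitions r (Suc N) l. [Suc N] \<in> D}. \<Prod>xs\<in>D. block_weight u v xs) =
     (if l = 0 then 0 else weight_sum u v r N (l - 1))"
proof (cases l)
  case 0
  \<comment> \<open>A distribution with this block is non-empty; finiteness is invoked because an
    infinite set also has \<open>card\<close> equal to 0.\<close>
  have "{D \<in> separated_partitions r (Suc N) l. [Suc N] \<in> D} = {}"
    using list_partition_finite 0 by (fastforce simp: separated_partitions_def)
  with 0 show ?thesis by (simp del: Collect_empty_eq)
next
  case (Suc l')
  let ?m = "Suc N"
  have fwd: "insert [?m] D \<in> separated_partitions r ?m l" "[?m] \<notin> D"
    if "D \<in> separated_partitions r N l'" for D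
  proof -
    have D: "list_partition {1..N} D" and fin: "finite D"
      using that list_partition_finite[of "{1..N}" D] by (simp_all add: separated_partitions_def)
    show notin: "[?m] \<notin> D"
      by (rule list_partition_insert(2)[OF D]) auto
    have "list_partition ({1..N} \<union> set [?m]) (insert [?m] D)"
      by (rule list_partition_insert(1)[OF D]) auto
    also have "{1..N} \<union> set [?m] = {1..?m}" by auto
    finally have "list_partition {1..?m} (insert [?m] D)" .
    moreover have "separated r [?m]" by (simp add: separated_def)
    moreover have "card (insert [?m] D) = Suc (card D)" using fin notin by simp
    ultimately show "insert [?m] D \<in> separated_partitions r ?m l"
      using that unfolding separated_partitions_def Suc by simp
  qed
  have bwd: "D - {[?m]} \<in> separated_partitions r N l'"
    if "D \<in> separated_partitions r ?m l" "[?m] \<in> D" for D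
  proof -
    have D: "list_partition {1..?m} D" and fin: "finite D"
      using that list_partition_finite[of "{1..?m}" D] by (simp_all add: separated_partitions_def)
    have "list_partition ({1..?m} - set [?m]) (D - {[?m]})"
      by (rule list_partition_remove[OF D that(2)])
    also have "{1..?m} - set [?m] = {1..N}" by auto
    finally have "list_partition {1..N} (D - {[?m]})" .
    moreover have "card (D - {[?m]}) = card D - 1" using fin that(2) by simp
    ultimately show ?thesis
      using that(1) unfolding separated_partitions_def Suc by simp
  qed
  have "weight_sum u v r N l' =
    (\<Sum>D\<in>{D \<in> separated_partitions r ?m l. [?m] \<in> D}. \<Prod>xs\<in>D. block_weight u v xs)"
    unfolding weight_sum_def
  proof (rule sum.reindex_bij_witness[where j = "insert [?m]" and i = "\<lambda>D. D - {[?m]}"])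
    fix D assume D: "D \<in> separated_partitions r N l'"
    then have "finite D"
      using list_partition_finite[of "{1..N}" D] by (simp add: separated_partitions_def)
    then show "(\<Prod>xs\<in>insert [?m] D. block_weight u v xs) = (\<Prod>xs\<in>D. block_weight u v xs)"
      using fwd(2)[OF D] by (simp add: block_weight_singleton)
  qed (use fwd bwd in auto)
  with Suc show ?thesis by simp
qed

text \<open>The inverse deletes \<open>Suc N\<close> from its block and remembers that block and the
  position. Excluding \<open>[Suc N]\<close> as a block ensures that the deletion leaves a non-empty
  list.\<close>

lemma bij_betw_insert_at:
  assumes "r \<le> N"
  shows "bij_betw (\<lambda>(D, xs, i). insert (insert_at (Suc N) i xs) (D - {xs}))
    (SIGMA D:separated_partitions r N l. SIGMA xs:D. {..length xs})
    {D \<in> separated_partitions r (Suc N) l. [Suc N] \<notin> D}"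
  unfolding bij_betw_def
proof
  let ?m = "Suc N"
  let ?h = "\<lambda>(D, xs, i). insert (insert_at ?m i xs) (D - {xs})"
  let ?I = "SIGMA D:separated_partitions r N l. SIGMA xs:D. {..length xs}"
  have notin: "?m \<notin> set xs" if "D \<in> separated_partitions r N l" "xs \<in> D" for D xs
  proof -
    have "set xs \<subseteq> {1..N}"
      using that by (auto simp: separated_partitions_def list_partition_def)
    then show ?thesis by auto
  qed
  have fwd: "?h (D, xs, i) \<in> separated_partitions r ?m l" "insert_at ?m i xs \<notin> D - {xs}"
      "[?m] \<notin> ?h (D, xs, i)"
    if DS: "D \<in> separated_partitions r N l" and xs: "xs \<in> D" for D xs i
  proof -
    let ?ys = "insert_at ?m i xs"
    have D: "list_partition {1..N} D" using DS by (auto simp: separated_partitions_def)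
    then have ne: "xs \<noteq> []" and dist: "distinct xs" and sub: "set xs \<subseteq> {1..N}"
      using xs by (auto simp: list_partition_def)
    have "distinct ?ys" using dist notin[OF DS xs] by (rule distinct_insert_at)
    moreover have "set ?ys \<inter> ({1..N} - set xs) = {}" "?ys \<noteq> []"
      by (auto simp: insert_at_def[of _ _ "[]"] simp flip: set_empty)
    ultimately have lp: "list_partition ({1..N} - set xs \<union> set ?ys) (insert ?ys (D - {xs}))"
      and card: "card (insert ?ys (D - {xs})) = card D" and "?ys \<notin> D - {xs}"
      using list_partition_replace[OF D _ xs, of ?ys] by auto
    then show "?ys \<notin> D - {xs}" by blast
    have "{1..N} - set xs \<union> set ?ys = {1..?m}" using sub by auto
    moreover have "separated r ?ys"
      using separated_insert_max[of r ?m "take i xs" "drop i xs"] assms DS xs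
      by (auto simp: insert_at_def separated_partitions_def)
    ultimately show "?h (D, xs, i) \<in> separated_partitions r ?m l"
      using lp card DS by (auto simp: separated_partitions_def)
    have "[?m] \<noteq> ?ys"
      using ne by (auto simp: insert_at_def Cons_eq_append_conv)
    moreover have "[?m] \<notin> D" using notin[OF DS, of "[?m]"] by auto
    ultimately show "[?m] \<notin> ?h (D, xs, i)" by auto
  qed
  show "inj_on ?h ?I"
  proof (rule inj_onI, clarsimp)
    fix D xs i E ys j
    assume D: "D \<in> separated_partitions r N l" "xs \<in> D" "i \<le> length xs"
      and E: "E \<in> separated_partitions r N l" "ys \<in> E" "j \<le> length ys"
      and eq: "insert (insert_at ?m i xs) (D - {xs}) = insert (insert_at ?m j ys) (E - {ys})"
        (is "?D' = ?E'")
    have "list_partition {1..?m} ?D'"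
      using fwd(1)[OF D(1,2)] by (simp add: separated_partitions_def)
    moreover have "insert_at ?m i xs \<in> ?D'" by simp
    moreover have "insert_at ?m j ys \<in> ?D'" unfolding eq by simp
    \<comment> \<open>Both new blocks contain \<open>Suc N\<close> and belong to the same partition,
      so they coincide.\<close>
    ultimately have same: "insert_at ?m i xs = insert_at ?m j ys"
      by (rule list_partition_unique_block[of _ _ _ _ ?m]) auto
    note inj = insert_at_inject[OF same notin[OF D(1,2)] notin[OF E(1,2)] D(3) E(3)]
    have "D - {xs} = E - {ys}"
      using eq same fwd(2)[OF D(1,2), of i] fwd(2)[OF E(1,2), of j]
      by (metis insert_ident)
    with inj D(2) E(2) show "D = E \<and> xs = ys \<and> i = j" by blast
  qed
  show "?h ` ?I = {D \<in> separated_partitions r ?m l. [?m] \<notin> D}"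
  proof
    show "?h ` ?I \<subseteq> {D \<in> separated_partitions r ?m l. [?m] \<notin> D}"
      using fwd(1,3) by fastforce
    show "{D \<in> separated_partitions r ?m l. [?m] \<notin> D} \<subseteq> ?h ` ?I"
    proof clarify
      fix D assume DS: "D \<in> separated_partitions r ?m l" and new: "[?m] \<notin> D"
      then have D: "list_partition {1..?m} D" by (auto simp: separated_partitions_def)
      then have "?m \<in> \<Union> (set ` D)" by (simp add: list_partition_def)
      then obtain ys where ys: "ys \<in> D" "?m \<in> set ys" by blast
      then obtain p q where pq: "ys = p @ ?m # q" by (meson split_list)
      let ?xs = "p @ q"
      have ne: "?xs \<noteq> []" using new ys pq by auto
      have dist: "distinct ys" and sub: "set ys \<subseteq> {1..?m}"
        using D ys by (auto simp: list_partition_def)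
      have ins: "insert_at ?m (length p) ?xs = ys" by (simp add: insert_at_def pq)
      have dist': "distinct ?xs" and m: "?m \<notin> set ?xs" using dist pq by auto
      have disj: "set ?xs \<inter> ({1..?m} - set ys) = {}" using pq by auto
      note E = list_partition_replace[OF D _ ys(1) disj ne dist']
      let ?E = "insert ?xs (D - {ys})"
      have "{1..?m} = insert ?m {1..N}" "?m \<notin> {1..N}" by auto
      moreover have "set ys = insert ?m (set ?xs)" using pq by simp
      moreover from calculation have "set ?xs \<subseteq> {1..N}"
        using sub m by (metis insert_subset subset_insert)
      \<comment> \<open>Used with \<open>c\<close> the maximum, \<open>B\<close> the interval
        \<open>{1..N}\<close> and \<open>X\<close> the set of the shortened block.\<close>
      moreover have "insert c B - insert c X \<union> X = B" if "c \<notin> B" "X \<subseteq> B" for c :: nat and B X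
        using that by blast
      ultimately have "{1..?m} - set ys \<union> set ?xs = {1..N}" by metis
      moreover have "separated r ?xs"
        using separated_insert_max[of r ?m p q] assms DS ys pq
        by (auto simp: separated_partitions_def)
      ultimately have "?E \<in> separated_partitions r N l"
        using E(1,3) DS by (auto simp: separated_partitions_def)
      then have "(?E, ?xs, length p) \<in> ?I" by simp
      moreover have "?h (?E, ?xs, length p) = D"
        using E(2) ys(1) unfolding prod.case ins by auto
      ultimately show "D \<in> ?h ` ?I" by (intro image_eqI[OF sym])
    qed
  qed
qed

text \<open>Through the bijection, a block \<open>xs\<close> has one front position with factor
  \<open>v\<close> and \<open>length xs\<close> others with factor \<open>u\<close>. Summed over the
  \<open>l\<close> blocks, whose lengths add up to \<open>N\<close>, these give the
  coefficient.\<close>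

lemma weight_sum_old_block:
  assumes "r \<le> N"
  shows "(\<Sum>D\<in>{D \<in> separated_partitions r (Suc N) l. [Suc N] \<notin> D}. \<Prod>xs\<in>D. block_weight u v xs) =
     (u * of_nat N + v * of_nat l) * weight_sum u v r N l"
proof -
  let ?m = "Suc N"
  define W where "W = (\<lambda>D. \<Prod>xs\<in>D. block_weight u v xs)"
  let ?h = "\<lambda>(D, xs, i). insert (insert_at ?m i xs) (D - {xs})"
  let ?I = "SIGMA D:separated_partitions r N l. SIGMA xs:D. {..length xs}"
  have bij: "bij_betw ?h ?I {D \<in> separated_partitions r ?m l. [?m] \<notin> D}"
    by (rule bij_betw_insert_at[OF assms])
  have fin: "finite D" if "D \<in> separated_partitions r N l" for D
    using that list_partition_finite[of "{1..N}" D] by (simp add: separated_partitions_def)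
  have W_insert: "W (insert (insert_at ?m i xs) (D - {xs})) = (if i = 0 then v else u) * W D"
    if DS: "D \<in> separated_partitions r N l" and xs: "xs \<in> D" for D xs i
  proof -
    have D: "list_partition {1..N} D" using DS by (auto simp: separated_partitions_def)
    then have ne: "xs \<noteq> []" and sub: "set xs \<subseteq> {1..N}"
      using xs by (auto simp: list_partition_def)
    have "\<forall>x\<in>set (take i xs @ drop i xs). x < ?m" using sub by auto
    from block_weight_insert_max[OF this, of u v] ne
    have bw: "block_weight u v (insert_at ?m i xs) =
        (if i = 0 then v else u) * block_weight u v xs"
      by (simp add: insert_at_def)
    have "insert_at ?m i xs \<notin> D"
    proof
      assume "insert_at ?m i xs \<in> D"
      then have "?m \<in> \<Union> (set ` D)" using set_insert_at[of ?m i xs] by blast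
      moreover have "\<Union> (set ` D) = {1..N}" using D unfolding list_partition_def by blast
      ultimately show False by simp
    qed
    then have "insert_at ?m i xs \<notin> D - {xs}" by blast
    then have "W (insert (insert_at ?m i xs) (D - {xs})) =
        block_weight u v (insert_at ?m i xs) * W (D - {xs})"
      using fin[OF DS] by (simp add: W_def)
    also have "\<dots> = (if i = 0 then v else u) * (block_weight u v xs * W (D - {xs}))"
      by (simp add: bw mult.assoc)
    also have "block_weight u v xs * W (D - {xs}) = W D"
      unfolding W_def by (rule prod.remove[OF fin[OF DS] xs, symmetric])
    finally show ?thesis .
  qed
  have positions: "(\<Sum>i\<le>n. if i = 0 then v else u) = v + u * of_nat n" for n
    by (induction n) (simp_all add: algebra_simps)
  have "(\<Sum>D\<in>{D \<in> separated_partitions r ?m l. [?m] \<notin> D}. W D) = (\<Sum>x\<in>?I. W (?h x))"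
    by (rule sum.reindex_bij_betw[OF bij, symmetric])
  also have "\<dots> = (\<Sum>D\<in>separated_partitions r N l. \<Sum>xs\<in>D. \<Sum>i\<le>length xs.
      W (insert (insert_at ?m i xs) (D - {xs})))"
    using fin finite_separated_partitions
    by (simp add: sum.Sigma split_def)
  also have "\<dots> = (\<Sum>D\<in>separated_partitions r N l. (u * of_nat N + v * of_nat l) * W D)"
  proof (rule sum.cong[OF refl])
    fix D assume DS: "D \<in> separated_partitions r N l"
    have "(\<Sum>xs\<in>D. \<Sum>i\<le>length xs. W (insert (insert_at ?m i xs) (D - {xs}))) =
        (\<Sum>xs\<in>D. \<Sum>i\<le>length xs. (if i = 0 then v else u) * W D)"
      by (intro sum.cong refl W_insert[OF DS])
    also have "\<dots> = (\<Sum>xs\<in>D. v + u * of_nat (length xs)) * W D"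
      by (simp only: sum_distrib_right[symmetric] positions)
    also have "(\<Sum>xs\<in>D. v + u * of_nat (length xs)) =
        v * of_nat (card D) + u * of_nat (\<Sum>xs\<in>D. length xs)"
      by (simp add: sum.distrib sum_distrib_left mult.commute)
    also have "(\<Sum>xs\<in>D. length xs) = N"
      using DS list_partition_sum_length[of "{1..N}" D] by (simp add: separated_partitions_def)
    also have "card D = l" using DS by (simp add: separated_partitions_def)
    finally show "(\<Sum>xs\<in>D. \<Sum>i\<le>length xs. W (insert (insert_at ?m i xs) (D - {xs}))) =
        (u * of_nat N + v * of_nat l) * W D"
      by (simp add: add.commute)
  qed
  finally show ?thesis by (simp add: W_def weight_sum_def sum_distrib_left)
qed

lemma weight_sum_Suc:
  assumes "r \<le> N"
  shows "weight_sum u v r (Suc N) l = (if l = 0 then 0 else weight_sum u v r N (l - 1)) +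
     (u * of_nat N + v * of_nat l) * weight_sum u v r N l"
proof -
  let ?S = "separated_partitions r (Suc N) l"
  have "?S = {D \<in> ?S. [Suc N] \<in> D} \<union> {D \<in> ?S. [Suc N] \<notin> D}" by blast
  then have "weight_sum u v r (Suc N) l =
      (\<Sum>D\<in>{D \<in> ?S. [Suc N] \<in> D} \<union> {D \<in> ?S. [Suc N] \<notin> D}. \<Prod>xs\<in>D. block_weight u v xs)"
    unfolding weight_sum_def by simp
  also have "\<dots> = (\<Sum>D\<in>{D \<in> ?S. [Suc N] \<in> D}. \<Prod>xs\<in>D. block_weight u v xs) +
      (\<Sum>D\<in>{D \<in> ?S. [Suc N] \<notin> D}. \<Prod>xs\<in>D. block_weight u v xs)"
    by (rule sum.union_disjoint) (auto simp: finite_separated_partitions)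
  finally show ?thesis
    unfolding weight_sum_new_block[OF assms] weight_sum_old_block[OF assms] .
qed

section \<open>Recurrence, sign rule and orthogonality for \<open>glah\<close>\<close>

text \<open>For \<open>l < r\<close> the recurrence only refers to block numbers below
  \<open>r\<close>, and the diagonal values there are 0.\<close>

lemma weight_sum_eq_0: "l < r \<Longrightarrow> weight_sum u v r (n + r) l = 0"
  by (induction n arbitrary: l) (auto simp: weight_sum_diagonal weight_sum_Suc)

lemma glah_0: "glah u v 0 k r = (if k = 0 then 1 else 0)"
  by (simp add: glah_eq_weight_sum weight_sum_diagonal)

lemma glah_Suc:
  "glah u v (Suc n) k r = (if k = 0 then 0 else glah u v n (k - 1) r) +
     (u * of_nat (n + r) + v * of_nat (k + r)) * glah u v n k r"
proof (cases k)
  case 0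
  then show ?thesis
    \<comment> \<open>For positive \<open>r\<close> and \<open>k = 0\<close> the new-block term has
      \<open>r - 1\<close> blocks and must be shown to vanish; for \<open>r = 0\<close> it is 0
      already.\<close>
    using weight_sum_eq_0[of "r - 1" r u v n]
    by (cases r) (simp_all add: glah_eq_weight_sum weight_sum_Suc)
next
  case (Suc k')
  then show ?thesis by (simp add: glah_eq_weight_sum weight_sum_Suc)
qed

lemma glah_eq_0: "n < k \<Longrightarrow> glah u v n k r = 0"
  by (induction n arbitrary: k) (auto simp: glah_0 glah_Suc)

text \<open>The recurrence either raises \<open>n\<close> and \<open>k\<close> together, preserving
  the parity of \<open>n + k\<close>, or raises \<open>n\<close> alone with a factor that is linear
  in \<open>u\<close> and \<open>v\<close> and changes sign.\<close>

lemma glah_uminus: "glah (- u) (- v) n k r = (-1) ^ (n + k) * glah u v n k r"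
proof (induction n arbitrary: k)
  case 0
  then show ?case by (simp add: glah_0)
next
  case (Suc n)
  then show ?case by (cases k) (simp_all add: glah_Suc algebra_simps)
qed

text \<open>With \<open>v = - u\<close> the coefficient in the recurrence is \<open>u\<close> times
  the difference of \<open>n\<close> and \<open>k\<close>. It vanishes at \<open>k = n\<close>, the
  only place where the induction hypothesis leaves a nonzero value.\<close>

lemma glah_orthogonal: "glah u (- u) n k r = (if n = k then 1 else 0)"
proof (induction n arbitrary: k)
  case 0
  then show ?case by (simp add: glah_0)
next
  case (Suc n)
  then show ?case by (cases k) (simp_all add: glah_Suc add.assoc)
qed

section \<open>The convolution and the two identities\<close>

text \<open>The range of \<open>j\<close> is kept independent of \<open>k\<close>, so that the
  induction can use the hypothesis at both \<open>k\<close> and \<open>k - 1\<close>.\<close>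

lemma glah_convolution_atMost:
  "glah a b n k r = (\<Sum>j\<le>n. glah a t n j r * glah (- t) b j k r)"
proof (induction n arbitrary: k)
  case 0
  then show ?case by (simp add: glah_0)
next
  case (Suc n)
  let ?F = "\<lambda>j. glah a t n j r" and ?G = "\<lambda>j k. glah (- t) b j k r"
  \<comment> \<open>The shift turns the new-block term of the first factor into
    \<open>?G (Suc j) k\<close>, to which the recurrence of the second factor applies.\<close>
  have shift: "(\<Sum>j\<le>Suc n. (if j = 0 then 0 else ?F (j - 1)) * ?G j k) = (\<Sum>j\<le>n. ?F j * ?G (Suc j) k)"
    by (subst sum.atMost_Suc_shift) simp
  have "(\<Sum>j\<le>Suc n. glah a t (Suc n) j r * ?G j k) =
      (\<Sum>j\<le>Suc n. (if j = 0 then 0 else ?F (j - 1)) * ?G j k) +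
      (\<Sum>j\<le>Suc n. (a * of_nat (n + r) + t * of_nat (j + r)) * ?F j * ?G j k)"
    unfolding glah_Suc[of a t n] by (simp only: distrib_right sum.distrib)
  \<comment> \<open>The term at \<open>j = Suc n\<close> drops out because \<open>?F (Suc n)\<close>
    is 0.\<close>
  also have "\<dots> = (\<Sum>j\<le>n. ?F j * (?G (Suc j) k + (a * of_nat (n + r) + t * of_nat (j + r)) * ?G j k))"
    unfolding shift by (simp add: glah_eq_0 sum.distrib[symmetric] algebra_simps)
  \<comment> \<open>Expanding \<open>?G (Suc j) k\<close> contributes
    \<open>- t * of_nat (j + r)\<close>, which cancels the \<open>t\<close> term and leaves a
    coefficient free of \<open>j\<close>.\<close>
  also have "\<dots> = (\<Sum>j\<le>n. (if k = 0 then 0 else ?F j * ?G j (k - 1)) +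
      (a * of_nat (n + r) + b * of_nat (k + r)) * (?F j * ?G j k))"
    unfolding glah_Suc[of "- t" b] by (intro sum.cong refl) (simp add: algebra_simps)
  also have "\<dots> = (if k = 0 then 0 else \<Sum>j\<le>n. ?F j * ?G j (k - 1)) +
      (a * of_nat (n + r) + b * of_nat (k + r)) * (\<Sum>j\<le>n. ?F j * ?G j k)"
    by (simp add: sum.distrib sum_distrib_left)
  also have "\<dots> = glah a b (Suc n) k r"
    unfolding Suc[symmetric] glah_Suc[of a b] by simp
  finally show ?case by simp
qed

lemma glah_convolution:
  "glah a b n k r = (\<Sum>j=k..n. glah a t n j r * glah (- t) b j k r)"
  unfolding glah_convolution_atMost[of a b n k r t]
  by (rule sum.mono_neutral_right) (auto simp: glah_eq_0)

theorem theorem3p2: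
  fixes a b t :: "'a::comm_ring_1" and n k r :: nat
  assumes "k \<le> n"
  shows "(if n = k then 1 else 0) =
           (\<Sum>j=k..n. (-1) ^ (j - k) * glah a b n j r * glah b a j k r) \<and>
         glah a b n k r = (\<Sum>j=k..n. glah a t n j r * glah (-t) b j k r)"
proof
  have "(if n = k then 1 else 0) = glah a (- a) n k r" by (simp add: glah_orthogonal)
  \<comment> \<open>The convolution with \<open>b\<close> as the intermediate parameter
    \<open>t\<close> and \<open>- a\<close> as the last parameter.\<close>
  also have "\<dots> = (\<Sum>j=k..n. glah a b n j r * glah (- b) (- a) j k r)"
    by (rule glah_convolution)
  also have "\<dots> = (\<Sum>j=k..n. (-1) ^ (j - k) * glah a b n j r * glah b a j k r)"
  proof (rule sum.cong[OF refl])
    fix j assume "j \<in> {k..n}"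
    \<comment> \<open>Since \<open>k\<close> is at most \<open>j\<close>, the sum and the truncated
      difference have the same parity.\<close>
    then have "(-1 :: 'a) ^ (j + k) = (-1) ^ (j - k)"
      by (simp add: minus_one_power_iff)
    then show "glah a b n j r * glah (- b) (- a) j k r =
        (-1) ^ (j - k) * glah a b n j r * glah b a j k r"
      by (simp add: glah_uminus mult_ac)
  qed
  finally show "(if n = k then 1 else 0) =
      (\<Sum>j=k..n. (-1) ^ (j - k) * glah a b n j r * glah b a j k r)" .
  show "glah a b n k r = (\<Sum>j=k..n. glah a t n j r * glah (-t) b j k r)"
    by (rule glah_convolution)
qed

end
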